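(* Let $E=\prod_{i=1}^\infty\mathbb{C}$ be equipped with the product $\sigma$-algebra $\bigotimes_{i=1}^{\infty}\mathcal{B}$, where $\mathcal{B}$ is the Borel $\sigma$-algebra of $\mathbb{C}$, and with the product measure $\mu=\bigotimes_{i=1}^{\infty}\mu_i$, where each $\mu_i$ is a probability measure on $(\mathbb{C},\mathcal{B})$. Let $\sigma:E\to\mathbb{C}$ be a closed-valued open-measurable multifunction, and define $$\sigma_\sim(x)=\bigcap_{n\ge 1}\ \bigcap_{\vec y\in\mathbb{C}^{n-1}}\sigma(\vec y,x_n,x_{n+1},\ldots),\qquad x\in E.$$ Then there exists a closed set $A\subset\mathbb{C}$ such that $\mu\{x\in E : \sigma_\sim(x)=A\}=1$.
   Context: A multifunction $F:E\to\mathbb{C}$ is a function assigning to each $x\in E$ a (possibly empty) subset $F(x)\subset\mathbb{C}$; it is closed-valued if every $F(x)$ is closed, and open-measurable if $\{x\in E : F(x)\cap U\neq\emptyset\}$ is measurable for every open $U\subset\mathbb{C}$. The measure $\mu$ is understood as extended to its completion, i.e. to all sets $B$ for which there are measurable $A_0\subset B\subset C_0$ with $\mu(C_0\setminus A_0)=0$. For $n=1$ the tuple $\vec y\in\mathbb{C}^0$ is empty, so the corresponding set is $\sigma(x)$ itself. The closed set $A$ may be empty. *)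

theory Defs
  imports "HOL-Probability.Probability"
begin

definition closed_valued :: "'a measure \<Rightarrow> ('a \<Rightarrow> 'b::topological_space set) \<Rightarrow> bool" where
  "closed_valued M F \<longleftrightarrow> (\<forall>x\<in>space M. closed (F x))"

definition open_measurable :: "'a measure \<Rightarrow> ('a \<Rightarrow> 'b::topological_space set) \<Rightarrow> bool" where
  "open_measurable M F \<longleftrightarrow> (\<forall>U. open U \<longrightarrow> {x \<in> space M. F x \<inter> U \<noteq> {}} \<in> sets M)"

(* Sequences are indexed from 0, so x_k in the usual numbering is "x (k - 1)".
   A vector of C^m is a list ys of length m, and replace_prefix ys x is
   (ys, x_{m+1}, x_{m+2}, ...): the first m entries of x are overwritten, not shifted. *)
definition replace_prefix :: "'a list \<Rightarrow> (nat \<Rightarrow> 'a) \<Rightarrow> nat \<Rightarrow> 'a" where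
  "replace_prefix ys x = (\<lambda>i. if i < length ys then ys ! i else x i)"

definition tail_multifunction ::
    "((nat \<Rightarrow> complex) \<Rightarrow> complex set) \<Rightarrow> (nat \<Rightarrow> complex) \<Rightarrow> complex set" where
  "tail_multifunction \<sigma> x =
     (\<Inter>n\<in>{1..}. \<Inter>ys\<in>{ys. length ys = n - 1}. \<sigma> (replace_prefix ys x))"

end

theory Submission
  imports Defs
begin

text \<open>
  A point lies outside the closed set \<open>tail_multifunction \<sigma> x\<close> iff some set \<open>B\<close> of a countable
  basis contains it and misses \<open>\<sigma>\<close> at some modification of finitely many entries of \<open>x\<close>. The set
  of those \<open>x\<close> for which \<open>B\<close> misses some modification is invariant under changing finitely
  many coordinates, so by Kolmogorov's zero-one law it has measure \<open>0\<close> or \<open>1\<close>, and \<open>A\<close> is the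
  complement of the union of those \<open>B\<close> for which the measure is \<open>1\<close>.

  This set is only the projection of a measurable set, so it need not be measurable, but it
  belongs to the completion. A measurable subset of \<open>M \<Otimes>\<^sub>M borel\<close> arises from rectangles with
  closed second factor by the Suslin operation; coding the points of the Polish factor by sequences
  of natural numbers, its projection arises from measurable sets by the Suslin operation. Such a set is
  inner regular by Choquet's capacity argument: bound the indices one at a time, losing little
  outer measure, until only finitely many choices remain at each stage.
\<close>

section \<open>The Suslin operation\<close>

text \<open>Replaces indexing by finite sequences: a stage of a Suslin scheme takes a whole branch
  \<open>f\<close> but reads only finitely many entries, so branches can be recoded by pairing
  functions without tracking lengths.\<close>

definition finitely_determined :: "(('i \<Rightarrow> 'v) \<Rightarrow> 'b) \<Rightarrow> bool" where
  "finitely_determined A \<longleftrightarrow> (\<exists>I. finite I \<and> (\<forall>f g. (\<forall>i\<in>I. f i = g i) \<longrightarrow> A f = A g))"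

lemma finitely_determined_const: "finitely_determined (\<lambda>_. c)"
  unfolding finitely_determined_def by auto

lemma finitely_determined_reindex:
  assumes "finitely_determined A"
  shows "finitely_determined (\<lambda>f. A (\<lambda>i. f (h i)))"
proof -
  obtain I where I: "finite I" "\<And>f g. (\<forall>i\<in>I. f i = g i) \<Longrightarrow> A f = A g"
    using assms unfolding finitely_determined_def by blast
  show ?thesis
    unfolding finitely_determined_def
    by (rule exI[of _ "h ` I"]) (auto intro!: I)
qed

lemma finitely_determined_eval: "finitely_determined (\<lambda>f. f i)"
  unfolding finitely_determined_def by (rule exI[of _ "{i}"]) auto

lemma finitely_determined_comp2:
  assumes "finitely_determined A" "finitely_determined B"
  shows "finitely_determined (\<lambda>f. h (A f) (B f))"
proof -
  obtain I where I: "finite I" "\<And>f g. (\<forall>i\<in>I. f i = g i) \<Longrightarrow> A f = A g"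
    using assms(1) unfolding finitely_determined_def by blast
  obtain J where J: "finite J" "\<And>f g. (\<forall>i\<in>J. f i = g i) \<Longrightarrow> B f = B g"
    using assms(2) unfolding finitely_determined_def by blast
  have "h (A f) (B f) = h (A g) (B g)" if "\<forall>i\<in>I \<union> J. f i = g i" for f g
    using I(2)[of f g] J(2)[of f g] that by auto
  then show ?thesis
    unfolding finitely_determined_def using I(1) J(1) by (intro exI[of _ "I \<union> J"]) auto
qed

lemma finitely_determined_Inter:
  assumes "finite K" "\<And>k. k \<in> K \<Longrightarrow> finitely_determined (A k)"
  shows "finitely_determined (\<lambda>f. \<Inter>k\<in>K. A k f)"
  using assms
proof (induction K rule: finite_induct)
  case empty
  then show ?case by (simp add: finitely_determined_const)
next
  case (insert k K)
  then have "finitely_determined (\<lambda>f. A k f \<inter> (\<Inter>k\<in>K. A k f))"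
    by (intro finitely_determined_comp2[of "A k" _ "(\<inter>)"]) auto
  then show ?case by simp
qed

text \<open>The classical operation: \<open>A n f\<close> stands for the set attached to a finite
  part of the branch \<open>f\<close>, and the result is the union over all branches of the
  intersections along them.\<close>

definition suslin_scheme :: "'a set set \<Rightarrow> (nat \<Rightarrow> (nat \<Rightarrow> nat) \<Rightarrow> 'a set) \<Rightarrow> 'a set \<Rightarrow> bool" where
  "suslin_scheme P A T \<longleftrightarrow> (\<forall>n. finitely_determined (A n)) \<and> (\<forall>n f. A n f \<in> P) \<and>
     (\<forall>p. p \<in> T \<longleftrightarrow> (\<exists>f. \<forall>n. p \<in> A n f))"

lemma suslin_schemeD:
  fixes A :: "nat \<Rightarrow> (nat \<Rightarrow> nat) \<Rightarrow> 'a set"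
  assumes "suslin_scheme P A T"
  shows "finitely_determined (A n)" "A n f \<in> P" "p \<in> T \<longleftrightarrow> (\<exists>f. \<forall>n. p \<in> A n f)"
  using assms unfolding suslin_scheme_def by auto

definition suslin_sets :: "'a set set \<Rightarrow> 'a set set" where
  "suslin_sets P = {T. \<exists>A. suslin_scheme P A T}"

lemma suslin_setsI:
  fixes A :: "nat \<Rightarrow> (nat \<Rightarrow> nat) \<Rightarrow> 'a set"
  assumes "\<And>n. finitely_determined (A n)" "\<And>n f. A n f \<in> P"
    and "\<And>p. p \<in> T \<longleftrightarrow> (\<exists>f. \<forall>n. p \<in> A n f)"
  shows "T \<in> suslin_sets P"
proof -
  have "suslin_scheme P A T" unfolding suslin_scheme_def using assms by simp
  then show ?thesis unfolding suslin_sets_def by blast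
qed

lemma suslin_setsE:
  assumes "T \<in> suslin_sets P"
  obtains A where "suslin_scheme P A T"
  using assms unfolding suslin_sets_def by blast

lemma suslin_sets_basic: "T \<in> P \<Longrightarrow> T \<in> suslin_sets P"
  by (rule suslin_setsI[of "\<lambda>_ _. T"]) (auto simp: finitely_determined_const)

lemma suslin_sets_seq:
  fixes T :: "nat \<Rightarrow> 'a set"
  assumes "\<And>j::nat. T j \<in> suslin_sets P"
  obtains A :: "nat \<Rightarrow> nat \<Rightarrow> (nat \<Rightarrow> nat) \<Rightarrow> 'a set" where "\<And>j. suslin_scheme P (A j) (T j)"
proof -
  have "\<forall>j. \<exists>A. suslin_scheme P A (T j)"
    using assms unfolding suslin_sets_def by simp
  then show ?thesis using that by metis
qed

text \<open>One branch can code a whole sequence of branches via \<open>prod_encode\<close>; stage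
  \<open>m\<close>, decoded as a pair \<open>(j, n)\<close>, then tests stage \<open>n\<close> of
  the scheme for \<open>T j\<close> along the \<open>j\<close>-th coded branch.\<close>

lemma suslin_sets_INT:
  assumes "\<And>j::nat. T j \<in> suslin_sets P"
  shows "(\<Inter>j. T j) \<in> suslin_sets P"
proof -
  obtain A where "\<And>j. suslin_scheme P (A j) (T j)"
    by (rule suslin_sets_seq[of T P, OF assms(1)]) (rule that)
  note A = suslin_schemeD[OF this]
  define A' where "A' m f = A (fst (prod_decode m)) (snd (prod_decode m))
      (\<lambda>i. f (prod_encode (fst (prod_decode m), i)))" for m and f :: "nat \<Rightarrow> nat"
  show ?thesis
  proof (rule suslin_setsI[of A'])
    show "finitely_determined (A' n)" for n
      unfolding A'_def by (rule finitely_determined_reindex[OF A(1)])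
    show "A' n f \<in> P" for n f
      unfolding A'_def by (rule A(2))
    fix p
    show "p \<in> (\<Inter>j. T j) \<longleftrightarrow> (\<exists>f. \<forall>n. p \<in> A' n f)"
    proof
      assume "p \<in> (\<Inter>j. T j)"
      then have "\<forall>j. \<exists>f. \<forall>n. p \<in> A j n f" using A(3) by auto
      then obtain F where F: "\<And>j n. p \<in> A j n (F j)" by metis
      then show "\<exists>f. \<forall>n. p \<in> A' n f"
        by (intro exI[of _ "\<lambda>m. F (fst (prod_decode m)) (snd (prod_decode m))"])
          (simp add: A'_def)
    next
      assume "\<exists>f. \<forall>n. p \<in> A' n f"
      then obtain f where f: "\<And>n. p \<in> A' n f" by blast
      have "p \<in> A j n (\<lambda>i. f (prod_encode (j, i)))" for j n
        using f[of "prod_encode (j, n)"] by (simp add: A'_def)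
      then show "p \<in> (\<Inter>j. T j)" using A(3) by blast
    qed
  qed
qed

text \<open>The entry \<open>f 0\<close> names the set to be entered and the shifted branch is the
  witness. Stages \<open>(j, n)\<close> with \<open>j\<close> different from \<open>f 0\<close>
  impose no condition, so they take the neutral value \<open>\<Omega>\<close>.\<close>

lemma suslin_sets_UN:
  assumes "\<And>j::nat. T j \<in> suslin_sets P" and "\<Omega> \<in> P" "P \<subseteq> Pow \<Omega>"
  shows "(\<Union>j. T j) \<in> suslin_sets P"
proof -
  obtain A where "\<And>j. suslin_scheme P (A j) (T j)"
    by (rule suslin_sets_seq[of T P, OF assms(1)]) (rule that)
  note A = suslin_schemeD[OF this]
  define A' where "A' m f = (if f 0 = fst (prod_decode m)
      then A (fst (prod_decode m)) (snd (prod_decode m)) (\<lambda>i. f (Suc i)) else \<Omega>)"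
    for m and f :: "nat \<Rightarrow> nat"
  show ?thesis
  proof (rule suslin_setsI[of A'])
    show "finitely_determined (A' n)" for n
      unfolding A'_def
      by (rule finitely_determined_comp2[of "\<lambda>f. f 0" _
            "\<lambda>k X. if k = fst (prod_decode n) then X else \<Omega>"])
        (rule finitely_determined_eval, rule finitely_determined_reindex[OF A(1)])
    show "A' n f \<in> P" for n f
      unfolding A'_def using A(2) assms(2) by simp
    fix p
    show "p \<in> (\<Union>j. T j) \<longleftrightarrow> (\<exists>f. \<forall>n. p \<in> A' n f)"
    proof
      assume "p \<in> (\<Union>j. T j)"
      then obtain j where "p \<in> T j" by blast
      then obtain f where f: "\<And>n. p \<in> A j n f" using A(3)[of p j] by blast
      have "p \<in> \<Omega>" using f[of 0] A(2) assms(3) by blast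
      with f show "\<exists>f. \<forall>n. p \<in> A' n f"
        by (intro exI[of _ "case_nat j f"]) (auto simp: A'_def)
    next
      assume "\<exists>f. \<forall>n. p \<in> A' n f"
      then obtain f where f: "\<And>n. p \<in> A' n f" by blast
      have "p \<in> A (f 0) n (\<lambda>i. f (Suc i))" for n
        using f[of "prod_encode (f 0, n)"] by (simp add: A'_def)
      then show "p \<in> (\<Union>j. T j)" using A(3)[of p "f 0"] by blast
    qed
  qed
qed

text \<open>Koenig's lemma in sequential form: by the pigeonhole principle the index set can be
  thinned coordinate by coordinate and stays infinite.\<close>

lemma finitely_branching_accumulation:
  fixes h :: "nat \<Rightarrow> nat \<Rightarrow> 'v"
  assumes "\<And>i. finite (range (\<lambda>l. h l i))"
  shows "\<exists>f. \<forall>j. infinite {l. \<forall>i<j. h l i = f i}"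
proof -
  have step: "\<exists>c. infinite {l\<in>L. h l i = c}" if "infinite L" for L i
    using pigeonhole_infinite[OF that, of "\<lambda>l. h l i"] assms[of i]
    by (meson finite_subset image_mono subset_UNIV)
  \<comment> \<open>\<open>c L i\<close> is a value taken infinitely often by coordinate
    \<open>i\<close> along \<open>L\<close>; the sets \<open>L i\<close> are the successive
    thinnings.\<close>
  define c where "c L i = (SOME c. infinite {l\<in>L. h l i = c})" for L i
  define L where "L = rec_nat UNIV (\<lambda>i L. {l\<in>L. h l i = c L i})"
  have L0: "L 0 = UNIV" and LS: "L (Suc i) = {l\<in>L i. h l i = c (L i) i}" for i
    by (simp_all add: L_def)
  have inf: "infinite (L i)" for i
  proof (induction i)
    case (Suc i)
    then show ?case unfolding LS c_def by (rule someI_ex[OF step])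
  qed (simp add: L0)
  have "L j = {l. \<forall>i<j. h l i = c (L i) i}" for j
    by (induction j) (auto simp: L0 LS less_Suc_eq)
  then show ?thesis using inf by (intro exI[of _ "\<lambda>i. c (L i) i"]) metis
qed

section \<open>Measurability of Suslin sets in the completion\<close>

text \<open>Outside, \<open>S\<close> has a measurable hull \<open>H\<close> of the same outer
  measure; inside, a countable union \<open>D\<close> of measurable subsets exhausts that measure.
  As the measure is finite, \<open>H - D\<close> is null.\<close>

lemma (in finite_measure) inner_regular_imp_completion:
  assumes "S \<subseteq> space M"
    and inner: "\<And>c. c < outer_measure_of M S \<Longrightarrow> \<exists>C\<in>sets M. C \<subseteq> S \<and> c \<le> emeasure M C"
  shows "S \<in> sets (completion M)"
proof -
  obtain H where H: "H \<in> sets M" "S \<subseteq> H" "outer_measure_of M S = emeasure M H"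
    using outer_measure_of_attain[OF assms(1)] by blast
  define \<C> where "\<C> = {C \<in> sets M. C \<subseteq> S}"
  have "{} \<in> \<C>" by (simp add: \<C>_def)
  then obtain f :: "nat \<Rightarrow> ennreal" where f: "range f \<subseteq> emeasure M ` \<C>" 
    and Supf: "(SUP C\<in>\<C>. emeasure M C) = (SUP i. f i)"
    using ennreal_SUP_countable_SUP[of \<C> "emeasure M"] by blast
  from f have "\<forall>i. \<exists>C\<in>\<C>. f i = emeasure M C" by blast
  then obtain C where C: "\<And>i. C i \<in> \<C>" "\<And>i. f i = emeasure M (C i)" by metis
  define D where "D = (\<Union>i. C i)"
  have D: "D \<in> sets M" "D \<subseteq> S" using C(1) by (auto simp: D_def \<C>_def)
  have "emeasure M H \<le> (SUP C\<in>\<C>. emeasure M C)"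
  proof (rule dense_le)
    fix c assume "c < emeasure M H"
    then obtain C where "C \<in> \<C>" "c \<le> emeasure M C"
      using inner[of c] H(3) by (auto simp: \<C>_def)
    then show "c \<le> (SUP C\<in>\<C>. emeasure M C)" by (meson SUP_upper2)
  qed
  also have "\<dots> = (SUP i. emeasure M (C i))" by (simp add: Supf C(2))
  also have "\<dots> \<le> emeasure M D"
    using C(1) D by (intro SUP_least emeasure_mono) (auto simp: D_def)
  finally have "emeasure M (H - D) = 0"
    using H D by (subst emeasure_Diff) (auto simp: diff_eq_0_iff_ennreal less_top[symmetric])
  then have "H - D \<in> null_sets M" using H D by auto
  then show ?thesis
    using D H by (intro sets_completionI[of S D "S - D" "H - D"]) auto
qed

text \<open>Choquet's argument uses two continuity properties: outer measure along increasing
  sequences of arbitrary sets, and measure along decreasing sequences of measurable sets.\<close>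

lemma (in finite_measure) suslin_sets_completion:
  assumes "S \<in> suslin_sets (sets M)"
  shows "S \<in> sets (completion M)"
proof -
  obtain A where "suslin_scheme (sets M) A S" using assms by (rule suslin_setsE)
  note A = suslin_schemeD[OF this]
  have A_space: "A n f \<subseteq> space M" for n f using A(2) by (rule sets.sets_into_space)
  have "\<forall>n. \<exists>I. finite I \<and> (\<forall>f g. (\<forall>i\<in>I. f i = g i) \<longrightarrow> A n f = A n g)"
    using A(1) by (simp add: finitely_determined_def)
  then obtain I where I: "\<And>n. finite (I n)"
      "\<And>n f g. (\<And>i. i \<in> I n \<Longrightarrow> f i = g i) \<Longrightarrow> A n f = A n g"
    by metis
  \<comment> \<open>The part of \<open>S\<close> witnessed by branches in \<open>X\<close>.\<close>
  define SX where "SX X = {x. \<exists>f\<in>X. \<forall>n. x \<in> A n f}" for X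
  have SX_space: "SX X \<subseteq> space M" for X using A_space by (auto simp: SX_def)
  have S_eq: "S = SX UNIV" using A(3) by (auto simp: SX_def)
  show ?thesis
  proof (rule inner_regular_imp_completion)
    show "S \<subseteq> space M" unfolding S_eq by (rule SX_space)
    fix c assume c: "c < outer_measure_of M S"
    \<comment> \<open>As \<open>k\<close> grows these parts increase to \<open>SX X\<close>, so some
      bound on entry \<open>j\<close> keeps the outer measure above \<open>c\<close>.\<close>
    have step: "\<exists>k. c < outer_measure_of M (SX (X \<inter> {f. f j \<le> k}))"
      if "c < outer_measure_of M (SX X)" for X j
    proof -
      have "(SUP k. outer_measure_of M (SX (X \<inter> {f. f j \<le> k})))
          = outer_measure_of M (\<Union>k. SX (X \<inter> {f. f j \<le> k}))"
        by (intro SUP_outer_measure_of_incseq SX_space)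
          (fastforce simp: incseq_def SX_def)
      also have "(\<Union>k. SX (X \<inter> {f. f j \<le> k})) = SX X"
        by (auto simp: SX_def)
      finally show ?thesis using that by (metis (no_types, lifting) less_SUP_iff)
    qed
    define k where "k X j = (SOME k. c < outer_measure_of M (SX (X \<inter> {f. f j \<le> k})))" for X j
    define X where "X = rec_nat UNIV (\<lambda>j X. X \<inter> {f. f j \<le> k X j})"
    have X0: "X 0 = UNIV" and XS: "X (Suc j) = X j \<inter> {f. f j \<le> k (X j) j}" for j
      by (simp_all add: X_def)
    have cX: "c < outer_measure_of M (SX (X j))" for j
    proof (induction j)
      case 0
      then show ?case using c by (simp add: X0 S_eq)
    next
      case (Suc j)
      then show ?case unfolding XS k_def by (rule someI_ex[OF step])
    qed
    define b where "b i = k (X i) i" for i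
    have X_eq: "X j = {f. \<forall>i<j. f i \<le> b i}" for j
      by (induction j) (auto simp: X0 XS b_def less_Suc_eq)
    \<comment> \<open>\<open>J j\<close> collects the stages below \<open>j\<close> that read only
      entries below \<open>j\<close>; each stage belongs to \<open>J j\<close> for all large
      \<open>j\<close>. On these stages a branch in \<open>X j\<close> may be truncated to one in
      the finite set \<open>F j\<close>, which makes the outer approximation \<open>C j\<close>
      measurable.\<close>
    define J where "J j = {n. n < j \<and> I n \<subseteq> {..<j}}" for j
    define F where "F j = {f. (\<forall>i<j. f i \<le> b i) \<and> (\<forall>i\<ge>j. f i = 0)}" for j
    define C where "C j = {x\<in>space M. \<exists>f\<in>X j. \<forall>n\<in>J j. x \<in> A n f}" for j
    have finF: "finite (F j)" for j
    proof (rule finite_subset)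
      show "F j \<subseteq> {f. \<forall>i. (i \<in> {..<j} \<longrightarrow> f i \<in> (\<Union>i<j. {..b i})) \<and> (i \<notin> {..<j} \<longrightarrow> f i = 0)}"
        by (auto simp: F_def)
      show "finite {f. \<forall>i. (i \<in> {..<j} \<longrightarrow> f i \<in> (\<Union>i<j. {..b i})) \<and> (i \<notin> {..<j} \<longrightarrow> f i = 0)}"
        by (rule finite_set_of_finite_funs) auto
    qed
    have "C j = (\<Union>f\<in>F j. {x\<in>space M. \<forall>n\<in>J j. x \<in> A n f})" for j
    proof -
      have "\<exists>f'\<in>F j. \<forall>n\<in>J j. A n f = A n f'" if "f \<in> X j" for f
      proof (rule bexI[of _ "\<lambda>i. if i < j then f i else 0"])
        show "\<forall>n\<in>J j. A n f = A n (\<lambda>i. if i < j then f i else 0)"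
          by (intro ballI I(2)) (auto simp: J_def)
      qed (use that in \<open>auto simp: F_def X_eq\<close>)
      moreover have "F j \<subseteq> X j" by (auto simp: F_def X_eq)
      ultimately show ?thesis unfolding C_def by (intro set_eqI iffI) (simp, metis, simp, metis subsetD)
    qed
    moreover have "{x\<in>space M. \<forall>n\<in>J j. x \<in> A n f} \<in> sets M" for j f
    proof -
      have "finite (J j)" by (rule finite_subset[of _ "{..<j}"]) (auto simp: J_def)
      moreover have "{x\<in>space M. x \<in> A n f} \<in> sets M" for n
        using A(2)[of n f] A_space[of n f] by (simp add: Collect_conj_eq Int_absorb1)
      ultimately show ?thesis by (intro sets.sets_Collect_finite_All)
    qed
    ultimately have C_sets: "C j \<in> sets M" for j
      using finF by (simp add: sets.finite_UN)
    have dec: "decseq C"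
    proof (rule decseq_SucI)
      fix n
      have "X (Suc n) \<subseteq> X n" "J n \<subseteq> J (Suc n)" by (auto simp: XS J_def)
      then show "C (Suc n) \<subseteq> C n" unfolding C_def by blast
    qed
    have "c \<le> emeasure M (C j)" for j
    proof -
      have "c \<le> outer_measure_of M (SX (X j))" using cX by (simp add: less_imp_le)
      also have "\<dots> \<le> outer_measure_of M (C j)"
        using A_space by (intro outer_measure_of_mono) (auto simp: SX_def C_def)
      finally show ?thesis using C_sets by simp
    qed
    then have "c \<le> (INF j. emeasure M (C j))" by (simp add: INF_greatest)
    also have "\<dots> = emeasure M (\<Inter>j. C j)"
      using C_sets dec by (intro INF_emeasure_decseq) auto
    finally have "c \<le> emeasure M (\<Inter>j. C j)" .
    \<comment> \<open>Compactness: the witnesses \<open>h l\<close> for \<open>C l\<close> satisfy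
      \<open>h l i \<le> b i\<close> once \<open>l > i\<close>, so each coordinate takes finitely
      many values and the witnesses accumulate at one branch \<open>f\<close>.\<close>
    moreover have "(\<Inter>j. C j) \<subseteq> S"
    proof
      fix x assume "x \<in> (\<Inter>j. C j)"
      then have "\<forall>j. \<exists>f\<in>X j. \<forall>n\<in>J j. x \<in> A n f" by (auto simp: C_def)
      then obtain h where h: "\<And>j. h j \<in> X j" "\<And>j n. n \<in> J j \<Longrightarrow> x \<in> A n (h j)" by metis
      have "finite (range (\<lambda>l. h l i))" for i
      proof (rule finite_subset)
        show "range (\<lambda>l. h l i) \<subseteq> {..b i} \<union> (\<lambda>l. h l i) ` {..i}"
        proof safe
          fix l assume "h l i \<notin> (\<lambda>l. h l i) ` {..i}"
          then have "i < l" by (metis atMost_iff imageI not_le)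
          then show "h l i \<le> b i" using h(1)[of l] by (simp add: X_eq)
        qed
      qed simp
      then obtain f where f: "\<And>j. infinite {l. \<forall>i<j. h l i = f i}"
        using finitely_branching_accumulation[of h] by blast
      have "x \<in> A n f" for n
      proof -
        obtain N where N: "I n \<subseteq> {..<N}" using I(1) finite_nat_iff_bounded by blast
        \<comment> \<open>\<open>l\<close> is so large that stage \<open>n\<close> lies in
          \<open>J l\<close>, while \<open>h l\<close> agrees with \<open>f\<close> on all entries
          read by that stage.\<close>
        obtain l where l: "l \<ge> max N (Suc n)" "\<forall>i<N. h l i = f i"
          using f[of N] unfolding infinite_nat_iff_unbounded_le by blast
        have "x \<in> A n (h l)" using l(1) N by (intro h(2)) (auto simp: J_def)
        also have "A n (h l) = A n f" using N l(2) by (intro I(2)) auto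
        finally show ?thesis .
      qed
      then show "x \<in> S" using A(3) by blast
    qed
    ultimately show "\<exists>C\<in>sets M. C \<subseteq> S \<and> c \<le> emeasure M C"
      using C_sets by blast
  qed
qed

section \<open>Measurable projection\<close>

text \<open>Closedness of the second factor later permits a completeness argument when that factor
  is projected away.\<close>

definition closed_rectangles :: "'a measure \<Rightarrow> ('a \<times> 'b::topological_space) set set" where
  "closed_rectangles M = {B \<times> D | B D. B \<in> sets M \<and> closed D}"

lemma open_eq_UN_closed:
  fixes U :: "'a::metric_space set"
  assumes "open U"
  obtains D :: "nat \<Rightarrow> 'a set" where "\<And>n. closed (D n)" "U = (\<Union>n. D n)"
proof
  \<comment> \<open>The points at distance at least \<open>1 / Suc n\<close> from every point
    outside \<open>U\<close>.\<close>
  define D where "D n = - (\<Union>y\<in>-U. ball y (1 / Suc n))" for n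
  show "closed (D n)" for n unfolding D_def by (intro closed_Compl open_UN) auto
  show "U = (\<Union>n. D n)"
  proof safe
    fix x assume "x \<in> U"
    then obtain e where e: "e > 0" "ball x e \<subseteq> U"
      using assms openE by blast
    obtain n where n: "1 / Suc n < e" using e(1) nat_approx_posE by blast
    have "x \<in> D n"
      using n e(2) by (force simp: D_def dist_commute)
    then show "x \<in> (\<Union>n. D n)" by blast
  next
    fix x n assume "x \<in> D n"
    then show "x \<in> U" using centre_in_ball[of x "1 / Suc n"] by (auto simp: D_def simp del: mem_ball centre_in_ball)
  qed
qed

lemma sets_pair_borel_suslin:
  fixes T :: "('a \<times> 'b::metric_space) set"
  assumes "T \<in> sets (M \<Otimes>\<^sub>M borel)"
  shows "T \<in> suslin_sets (closed_rectangles M)"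
proof -
  define \<Omega> :: "('a \<times> 'b) set" where "\<Omega> = space M \<times> UNIV"
  let ?P = "closed_rectangles M :: ('a \<times> 'b) set set"
  \<comment> \<open>Suslin sets need not be closed under complements, so complements are built in:
    \<open>\<D>\<close> is a \<sigma>-algebra because Suslin sets admit countable unions and
    intersections.\<close>
  define \<D> where "\<D> = {T. T \<subseteq> \<Omega> \<and> T \<in> suslin_sets ?P \<and> \<Omega> - T \<in> suslin_sets ?P}"
  have P_rect: "B \<times> D \<in> ?P" if "B \<in> sets M" "closed D" for B and D :: "'b set"
    using that by (auto simp: closed_rectangles_def)
  have P\<Omega>: "\<Omega> \<in> ?P" unfolding \<Omega>_def by (rule P_rect) auto
  have P_sub: "?P \<subseteq> Pow \<Omega>"
    using sets.sets_into_space by (fastforce simp: closed_rectangles_def \<Omega>_def)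
  have P0: "{} \<in> ?P" using P_rect[of "{}" "{}"] by simp
  have sigma: "sigma_algebra \<Omega> \<D>"
    unfolding sigma_algebra_iff2
  proof (intro conjI ballI allI impI)
    show "\<D> \<subseteq> Pow \<Omega>" by (auto simp: \<D>_def)
    show "{} \<in> \<D>" using P0 P\<Omega> by (auto simp: \<D>_def intro: suslin_sets_basic)
    show "\<Omega> - T \<in> \<D>" if "T \<in> \<D>" for T
      using that by (auto simp: \<D>_def double_diff)
    fix T :: "nat \<Rightarrow> ('a \<times> 'b) set" assume T: "range T \<subseteq> \<D>"
    have "(\<Union>j. T j) \<in> suslin_sets ?P"
      using T by (intro suslin_sets_UN[OF _ P\<Omega> P_sub]) (auto simp: \<D>_def)
    moreover have "(\<Inter>j. \<Omega> - T j) \<in> suslin_sets ?P"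
      using T by (intro suslin_sets_INT) (auto simp: \<D>_def)
    moreover have "(\<Inter>j. \<Omega> - T j) = \<Omega> - (\<Union>j. T j)" by auto
    moreover have "(\<Union>j. T j) \<subseteq> \<Omega>" using T by (auto simp: \<D>_def)
    ultimately show "(\<Union>j. T j) \<in> \<D>"
      unfolding \<D>_def by simp
  qed
  define N where "N = measure_of \<Omega> \<D> (\<lambda>_. 0)"
  have N: "space N = \<Omega>" "sets N = \<D>"
    using sigma sigma_algebra.sets_measure_of_eq[OF sigma] sigma_algebra.space_measure_of_eq[OF sigma]
    by (simp_all add: N_def)
  have "sets (M \<Otimes>\<^sub>M (borel :: 'b measure)) \<subseteq> sets N"
  proof (rule sets_pair_in_sets)
    fix B and D :: "'b set" assume B: "B \<in> sets M" and D: "D \<in> sets borel"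
    have "B \<times> UNIV \<in> \<D>"
    proof -
      have "\<Omega> - B \<times> UNIV = (space M - B) \<times> UNIV" by (auto simp: \<Omega>_def)
      then show ?thesis
        using B sets.sets_into_space[OF B]
        by (auto simp: \<D>_def \<Omega>_def intro!: suslin_sets_basic P_rect)
    qed
    \<comment> \<open>It suffices to treat open \<open>U\<close>: \<open>space M \<times> U\<close>
      is a countable union of closed rectangles, and its complement is itself one.\<close>
    moreover have "snd \<in> borel_measurable N"
    proof (rule borel_measurableI)
      fix U :: "'b set" assume "open U"
      then obtain F :: "nat \<Rightarrow> 'b set" where F: "\<And>n. closed (F n)" "U = (\<Union>n. F n)"
        using open_eq_UN_closed by blast
      have "space M \<times> U = (\<Union>n. space M \<times> F n)" using F(2) by auto
      moreover have "(\<Union>n. space M \<times> F n) \<in> suslin_sets ?P"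
        using F(1) by (intro suslin_sets_UN[OF _ P\<Omega> P_sub] suslin_sets_basic P_rect) auto
      moreover have "\<Omega> - space M \<times> U \<in> suslin_sets ?P"
      proof -
        have "\<Omega> - space M \<times> U = space M \<times> (- U)" by (auto simp: \<Omega>_def)
        then show ?thesis
          using \<open>open U\<close> by (auto intro!: suslin_sets_basic P_rect)
      qed
      moreover have "snd -` U \<inter> space N = space M \<times> U" by (auto simp: N \<Omega>_def)
      ultimately show "snd -` U \<inter> space N \<in> sets N"
        by (auto simp: N \<D>_def \<Omega>_def)
    qed
    then have "snd -` D \<inter> space N \<in> sets N" using D by (rule measurable_sets)
    ultimately have "(B \<times> UNIV) \<inter> (snd -` D \<inter> space N) \<in> sets N"
      by (metis N(2) sets.Int)
    moreover have "(B \<times> UNIV) \<inter> (snd -` D \<inter> space N) = B \<times> D"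
      using sets.sets_into_space[OF B] by (auto simp: N \<Omega>_def)
    ultimately show "B \<times> D \<in> sets N" by simp
  qed
  then show ?thesis using assms by (auto simp: N \<D>_def)
qed

text \<open>A new branch carries both a branch for \<open>T\<close> and a code for the point
  \<open>y\<close> to be projected away; completeness recovers \<open>y\<close> from the
  code.\<close>

lemma suslin_sets_projection:
  fixes T :: "('a \<times> 'b::polish_space) set"
  assumes "T \<in> suslin_sets (closed_rectangles M)"
  shows "fst ` T \<in> suslin_sets (sets M)"
proof -
  let ?P = "closed_rectangles M :: ('a \<times> 'b) set set"
  obtain A where "suslin_scheme ?P A T" using assms by (rule suslin_setsE)
  note A = suslin_schemeD[OF this]
  have "\<forall>R\<in>?P. \<exists>B D. B \<in> sets M \<and> closed D \<and> R = B \<times> D"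
    by (auto simp: closed_rectangles_def)
  then obtain b d where bd: "\<And>R. R \<in> ?P \<Longrightarrow> b R \<in> sets M"
      "\<And>R. R \<in> ?P \<Longrightarrow> closed (d R)" "\<And>R. R \<in> ?P \<Longrightarrow> R = b R \<times> d R"
    by metis
  obtain Q :: "'b set" where Q: "countable Q" "\<And>X. open X \<Longrightarrow> X \<noteq> {} \<Longrightarrow> \<exists>q\<in>Q. q \<in> X"
    using countable_dense_exists by blast
  have "Q \<noteq> {}" using Q(2)[of UNIV] by auto
  define q where "q = from_nat_into Q"
  have q: "\<exists>i. dist (q i) y \<le> e" if e: "e > 0" for y e
  proof -
    obtain z where "z \<in> Q" "z \<in> ball y e" using Q(2)[OF open_ball, of y e] centre_in_ball[of y e] e by blast
    moreover obtain i where "q i = z"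
      using from_nat_into_surj[OF Q(1) \<open>z \<in> Q\<close>] unfolding q_def by blast
    ultimately show ?thesis by (intro exI[of _ i]) (auto simp: dist_commute)
  qed
  \<comment> \<open>The even entries of \<open>h\<close> are the index of the scheme for \<open>T\<close>, the odd ones code a point of
    the Polish factor by a sequence of balls around points of \<open>Q\<close>.\<close>
  define S where "S n h = (\<Inter>k\<in>{..n}. d (A k (\<lambda>i. h (2 * i))) \<inter> cball (q (h (2 * k + 1))) (1 / Suc k))"
    for n and h :: "nat \<Rightarrow> nat"
  \<comment> \<open>The condition on \<open>x\<close> survives only while the closed conditions on
    \<open>y\<close> up to stage \<open>n\<close> are compatible.\<close>
  define A' where "A' n h = (if S n h = {} then {} else b (A n (\<lambda>i. h (2 * i))))" for n h
  have fd: "finitely_determined (\<lambda>h. A n (\<lambda>i. h (2 * i)))" for n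
    by (rule finitely_determined_reindex[OF A(1)])
  show ?thesis
  proof (rule suslin_setsI[of A'])
    show "finitely_determined (A' n)" for n
    proof -
      have "finitely_determined (S n)"
        unfolding S_def
        by (intro finitely_determined_Inter
            finitely_determined_comp2[of "\<lambda>h. A k (\<lambda>i. h (2 * i))" "\<lambda>h. h (2 * k + 1)"
              "\<lambda>R v. d R \<inter> cball (q v) (1 / Suc k)" for k] fd finitely_determined_eval) auto
      then show ?thesis
        unfolding A'_def
        by (intro finitely_determined_comp2[of "S n" "\<lambda>h. A n (\<lambda>i. h (2 * i))"
              "\<lambda>X R. if X = {} then {} else b R"] fd)
    qed
    show "A' n h \<in> sets M" for n h
      using bd(1) A(2) by (auto simp: A'_def)
    fix x
    show "x \<in> fst ` T \<longleftrightarrow> (\<exists>h. \<forall>n. x \<in> A' n h)"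
    proof
      assume "x \<in> fst ` T"
      then obtain y where "(x, y) \<in> T" by auto
      then obtain f where "\<And>n. (x, y) \<in> A n f" using A(3) by blast
      then have f: "(x, y) \<in> b (A n f) \<times> d (A n f)" for n using bd(3) A(2) by metis
      have "\<forall>k. \<exists>i. dist (q i) y \<le> 1 / Suc k" using q by simp
      then obtain g where g: "\<And>k. dist (q (g k)) y \<le> 1 / Suc k" by metis
      define h where "h m = (if even m then f (m div 2) else g (m div 2))" for m
      have h: "(\<lambda>i. h (2 * i)) = f" "\<And>k. h (Suc (2 * k)) = g k" by (auto simp: h_def)
      have "y \<in> S n h" for n using f g by (auto simp: S_def h simp del: of_nat_Suc)
      then have "x \<in> A' n h" for n using f by (auto simp: A'_def h)
      then show "\<exists>h. \<forall>n. x \<in> A' n h" by blast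
    next
      assume "\<exists>h. \<forall>n. x \<in> A' n h"
      then obtain h where h: "\<And>n. x \<in> A' n h" by blast
      define f where "f = (\<lambda>i. h (2 * i))"
      have xb: "x \<in> b (A n f)" for n using h[of n] by (auto simp: A'_def f_def split: if_splits)
      have ne: "S n h \<noteq> {}" for n using h[of n] by (auto simp: A'_def split: if_splits)
      have cl: "closed (S n h)" for n
        unfolding S_def using bd(2) A(2) by (intro closed_INT ballI closed_Int closed_cball) auto
      have dec: "S n h \<subseteq> S m h" if "m \<le> n" for m n using that by (force simp: S_def)
      have small: "\<exists>n. \<forall>y\<in>S n h. \<forall>z\<in>S n h. dist y z < e" if e: "e > 0" for e
      proof -
        obtain n where n: "1 / Suc n < e / 2" using e nat_approx_posE[of "e / 2"] by auto
        have "dist y z < e" if "y \<in> S n h" "z \<in> S n h" for y z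
        proof -
          have "dist (q (h (2 * n + 1))) y \<le> 1 / Suc n" "dist (q (h (2 * n + 1))) z \<le> 1 / Suc n"
            using that by (auto simp: S_def simp del: of_nat_Suc)
          then show ?thesis using n dist_triangle3[of y z "q (h (2 * n + 1))"] by linarith
        qed
        then show ?thesis by blast
      qed
      \<comment> \<open>Nested nonempty closed sets with diameters tending to 0 have a common point
        in a complete space.\<close>
      obtain y where y: "\<And>n. y \<in> S n h"
        using decreasing_closed_nest[of "\<lambda>n. S n h"] cl ne dec small by metis
      have "y \<in> d (A n f)" for n using y[of n] by (auto simp: S_def f_def)
      with xb have "(x, y) \<in> A n f" for n using bd(3) A(2) by (metis mem_Sigma_iff)
      then have "(x, y) \<in> T" using A(3) by blast
      then show "x \<in> fst ` T" by force
    qed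
  qed
qed

theorem (in finite_measure) measurable_projection:
  fixes T :: "('a \<times> 'b::polish_space) set"
  assumes "T \<in> sets (M \<Otimes>\<^sub>M borel)"
  shows "fst ` T \<in> sets (completion M)"
  using assms by (intro suslin_sets_completion suslin_sets_projection sets_pair_borel_suslin)

section \<open>Tail sets and the zero-one law\<close>

text \<open>
  Unlike \<open>replace_prefix\<close>, the new entries come from a whole sequence, so that they range over a
  Polish type.
\<close>
definition prefix_splice :: "nat \<Rightarrow> (nat \<Rightarrow> 'a) \<Rightarrow> (nat \<Rightarrow> 'a) \<Rightarrow> nat \<Rightarrow> 'a" where
  "prefix_splice k y x = (\<lambda>i. if i < k then y i else x i)"

lemma measurable_splice [measurable]:
  "(\<lambda>(y, x). prefix_splice k y x) \<in> PiM UNIV M \<Otimes>\<^sub>M PiM UNIV M \<rightarrow>\<^sub>M PiM UNIV M"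
proof (rule measurable_PiM_single')
  show "(\<lambda>p. (case p of (y, x) \<Rightarrow> prefix_splice k y x) i) \<in> PiM UNIV M \<Otimes>\<^sub>M PiM UNIV M \<rightarrow>\<^sub>M M i" for i
    by (cases "i < k") (auto simp: prefix_splice_def split_beta)
  show "(\<lambda>(y, x). prefix_splice k y x) \<in> space (PiM UNIV M \<Otimes>\<^sub>M PiM UNIV M) \<rightarrow> (\<Pi>\<^sub>E i\<in>UNIV. space (M i))"
    by (auto simp: prefix_splice_def space_pair_measure space_PiM PiE_def Pi_def)
qed

lemma mem_prod_emb_PiE:
  "x \<in> prod_emb UNIV M J (Pi\<^sub>E J A) \<longleftrightarrow> x \<in> space (PiM UNIV M) \<and> (\<forall>i\<in>J. x i \<in> A i)"
  by (auto simp: prod_emb_def space_PiM PiE_def Pi_def)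

text \<open>Taking the first \<open>k\<close> coordinates from an independent copy leaves the
  product law unchanged: the preimage of a cylinder is a product of two cylinders, and cylinders
  determine the measure.\<close>

lemma distr_splice:
  fixes M :: "nat \<Rightarrow> 'a measure"
  assumes "\<And>i. prob_space (M i)"
  shows "distr (PiM UNIV M \<Otimes>\<^sub>M PiM UNIV M) (PiM UNIV M) (\<lambda>(y, x). prefix_splice k y x) = PiM UNIV M"
proof -
  let ?P = "PiM UNIV M"
  interpret P: prob_space ?P using assms by (intro prob_space_PiM)
  interpret PP: pair_prob_space ?P ?P ..
  show ?thesis
  proof (rule measure_eqI_PiM_infinite[of _ UNIV M])
    show "finite_measure (distr (?P \<Otimes>\<^sub>M ?P) ?P (\<lambda>(y, x). prefix_splice k y x))"
      by (intro PP.finite_measure_distr measurable_splice)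
    fix A and J :: "nat set" assume J: "finite J" and A: "\<And>i. i \<in> J \<Longrightarrow> A i \<in> sets (M i)"
    define cyl where "cyl L = prod_emb UNIV M L (Pi\<^sub>E L A)" for L
    have cyl_sets: "cyl L \<in> sets ?P" and cyl_em: "emeasure ?P (cyl L) = (\<Prod>i\<in>L. emeasure (M i) (A i))"
      if "L \<subseteq> J" for L
      using that J A finite_subset[OF that J] unfolding cyl_def
      by (auto intro!: sets_PiM_I emeasure_PiM_emb assms)
    have cyl_iff: "x \<in> cyl L \<longleftrightarrow> x \<in> space ?P \<and> (\<forall>i\<in>L. x i \<in> A i)" for x L
      unfolding cyl_def by (rule mem_prod_emb_PiE)
    have "(\<lambda>(y, x). prefix_splice k y x) -` cyl J \<inter> space (?P \<Otimes>\<^sub>M ?P) = cyl (J \<inter> {..<k}) \<times> cyl (J - {..<k})"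
      by (auto simp: cyl_iff prefix_splice_def space_pair_measure space_PiM PiE_iff split: if_splits)
    then have "emeasure (distr (?P \<Otimes>\<^sub>M ?P) ?P (\<lambda>(y, x). prefix_splice k y x)) (cyl J)
        = emeasure ?P (cyl (J \<inter> {..<k})) * emeasure ?P (cyl (J - {..<k}))"
      by (simp add: emeasure_distr cyl_sets P.emeasure_pair_measure_Times)
    also have "\<dots> = emeasure ?P (cyl J)"
      using J by (simp add: cyl_em prod.Int_Diff[of J _ "{..<k}"])
    finally show "emeasure (distr (?P \<Otimes>\<^sub>M ?P) ?P (\<lambda>(y, x). prefix_splice k y x)) (prod_emb UNIV M J (Pi\<^sub>E J A))
        = emeasure ?P (prod_emb UNIV M J (Pi\<^sub>E J A))" by (simp add: cyl_def)
  qed simp_all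
qed

text \<open>After splicing two independent copies \<open>y\<close> and \<open>x\<close>, a cylinder
  over coordinates below \<open>k\<close> depends only on \<open>y\<close> and membership in
  \<open>T\<close> only on \<open>x\<close>. This makes \<open>T\<close> independent of
  itself.\<close>

lemma tail_set_zero_one:
  fixes M :: "nat \<Rightarrow> 'a measure"
  assumes prob: "\<And>i. prob_space (M i)"
    and T: "T \<in> sets (completion (PiM UNIV M))"
    and tail: "\<And>k y x. y \<in> space (PiM UNIV M) \<Longrightarrow> x \<in> space (PiM UNIV M) \<Longrightarrow> prefix_splice k y x \<in> T \<longleftrightarrow> x \<in> T"
  shows "emeasure (completion (PiM UNIV M)) T = 0 \<or> emeasure (completion (PiM UNIV M)) T = 1"
proof -
  let ?P = "PiM UNIV M"
  interpret P: prob_space ?P using prob by (intro prob_space_PiM)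
  define L where "L = main_part ?P T"
  obtain N where N: "null_part ?P T \<subseteq> N" "N \<in> null_sets ?P"
    using null_part[OF T] by blast
  have L: "L \<in> sets ?P" unfolding L_def using T by (rule main_part_sets)
  have T_eq: "L \<union> null_part ?P T = T" unfolding L_def using T by (rule main_part_null_part_Un)
  \<comment> \<open>\<open>T\<close> is trapped between measurable \<open>L\<close> and
    \<open>U\<close> that differ by a null set, so that the product measure is applied only to
    measurable sets.\<close>
  define U where "U = L \<union> N"
  have U: "U \<in> sets ?P" and LTU: "L \<subseteq> T" "T \<subseteq> U"
    using L N T_eq by (auto simp: U_def)
  have U_Int: "emeasure ?P (C \<inter> U) = emeasure ?P (C \<inter> L)" if "C \<in> sets ?P" for C
  proof -
    have "emeasure ?P ((C \<inter> L) \<union> (C \<inter> N)) = emeasure ?P (C \<inter> L)"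
      using that L N by (intro emeasure_Un_null_set) (auto intro: null_set_Int1 null_set_Int2)
    then show ?thesis by (simp add: U_def Int_Un_distrib)
  qed
  define p where "p = emeasure ?P L"
  have pU: "emeasure ?P U = p"
    using U_Int[OF sets.top] sets.sets_into_space[OF L] sets.sets_into_space[OF U]
    by (simp add: p_def Int_absorb1)
  have splice_em: "emeasure (?P \<Otimes>\<^sub>M ?P) ((\<lambda>(y, x). prefix_splice k y x) -` B \<inter> space (?P \<Otimes>\<^sub>M ?P)) = emeasure ?P B"
    if "B \<in> sets ?P" for B k
    using that distr_splice[OF prob, where k=k] emeasure_distr[OF measurable_splice[where k=k and M=M] that] by simp
  \<comment> \<open>\<open>T\<close> is independent of every cylinder, hence of \<open>L\<close>, which is \<open>T\<close> up to a null set.\<close>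
  have "density ?P (indicator L) = scale_measure p ?P"
  proof (rule measure_eqI_PiM_infinite[of _ UNIV M])
    show "finite_measure (density ?P (indicator L))"
      using L by (intro finite_measureI) (auto simp: emeasure_density)
    fix A and J :: "nat set" assume J: "finite J" and A: "\<And>i. i \<in> J \<Longrightarrow> A i \<in> sets (M i)"
    define C where "C = prod_emb UNIV M J (Pi\<^sub>E J A)"
    have C: "C \<in> sets ?P" using J A unfolding C_def by (auto intro!: sets_PiM_I)
    obtain k where k: "J \<subseteq> {..<k}" using J finite_nat_iff_bounded by blast
    let ?G = "\<lambda>(y, x). prefix_splice k y x"
    have C_iff: "x \<in> C \<longleftrightarrow> x \<in> space ?P \<and> (\<forall>i\<in>J. x i \<in> A i)" for x
      unfolding C_def by (rule mem_prod_emb_PiE)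
    have spl: "prefix_splice k y x \<in> C \<longleftrightarrow> y \<in> C" if "y \<in> space ?P" "x \<in> space ?P" for x y
    proof -
      have "prefix_splice k y x i = y i" if "i \<in> J" for i
        using that k by (auto simp: prefix_splice_def)
      moreover have "prefix_splice k y x \<in> space ?P"
        using that by (auto simp: prefix_splice_def space_PiM PiE_iff)
      ultimately show ?thesis using that by (simp add: C_iff)
    qed
    \<comment> \<open>If the spliced point is in \<open>C \<inter> L\<close>, then \<open>y\<close>
      is in \<open>C\<close>, and \<open>x\<close> is in \<open>T\<close> by the tail property,
      hence in \<open>U\<close>. The reverse estimate below starts from \<open>C \<times> L\<close>
      and ends in \<open>C \<inter> U\<close>.\<close>
    have "emeasure ?P (C \<inter> L) = emeasure (?P \<Otimes>\<^sub>M ?P) (?G -` (C \<inter> L) \<inter> space (?P \<Otimes>\<^sub>M ?P))"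
      using C L by (intro splice_em[symmetric]) auto
    also have "\<dots> \<le> emeasure (?P \<Otimes>\<^sub>M ?P) (C \<times> U)"
      using LTU C U by (intro emeasure_mono) (auto simp: space_pair_measure spl dest: subsetD tail[THEN iffD1, rotated 2])
    also have "\<dots> = emeasure ?P C * p"
      using C U by (simp add: P.emeasure_pair_measure_Times pU)
    finally have le: "emeasure ?P (C \<inter> L) \<le> emeasure ?P C * p" .
    have "emeasure ?P C * p = emeasure (?P \<Otimes>\<^sub>M ?P) (C \<times> L)"
      using C L by (simp add: P.emeasure_pair_measure_Times p_def)
    also have "\<dots> \<le> emeasure (?P \<Otimes>\<^sub>M ?P) (?G -` (C \<inter> U) \<inter> space (?P \<Otimes>\<^sub>M ?P))"
    proof (rule emeasure_mono)
      show "C \<times> L \<subseteq> ?G -` (C \<inter> U) \<inter> space (?P \<Otimes>\<^sub>M ?P)"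
      proof clarify
        fix y x assume yx: "y \<in> C" "x \<in> L"
        then have sp: "y \<in> space ?P" "x \<in> space ?P"
          using C L sets.sets_into_space by blast+
        then show "(y, x) \<in> ?G -` (C \<inter> U) \<inter> space (?P \<Otimes>\<^sub>M ?P)"
          using yx spl[OF sp] tail[OF sp, of k] LTU by (auto simp: space_pair_measure)
      qed
      show "?G -` (C \<inter> U) \<inter> space (?P \<Otimes>\<^sub>M ?P) \<in> sets (?P \<Otimes>\<^sub>M ?P)"
        using C U by (intro measurable_sets[OF measurable_splice]) auto
    qed
    also have "\<dots> = emeasure ?P (C \<inter> U)"
      using C U by (intro splice_em) auto
    also have "\<dots> = emeasure ?P (C \<inter> L)"
      using C by (rule U_Int)
    finally have "emeasure ?P (C \<inter> L) = emeasure ?P C * p" using le by simp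
    then show "emeasure (density ?P (indicator L)) (prod_emb UNIV M J (Pi\<^sub>E J A))
        = emeasure (scale_measure p ?P) (prod_emb UNIV M J (Pi\<^sub>E J A))"
      using C L unfolding C_def[symmetric]
      by (simp add: emeasure_density indicator_inter_arith[symmetric] Int_commute mult.commute)
  qed simp_all
  \<comment> \<open>Evaluating both measures at \<open>L\<close> itself gives
    \<open>p = p * p\<close>.\<close>
  then have "emeasure (density ?P (indicator L)) L = emeasure (scale_measure p ?P) L" by simp
  then have "p = p * p"
    using L by (simp add: emeasure_density indicator_inter_arith[symmetric] p_def)
  moreover have "p \<noteq> \<top>" by (simp add: p_def)
  ultimately have "p = 0 \<or> p = 1"
    by (cases p) (auto simp flip: ennreal_mult)
  then show ?thesis
    using T by (simp add: p_def L_def)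
qed

section \<open>From the tail multifunction to countably many tail sets\<close>

text \<open>Prepares the projection: the spliced-in sequence \<open>y\<close> must carry the Borel
  sets of a Polish space, which here agree with the product \<sigma>-algebra, and must be the second
  component.\<close>

lemma measurable_splice_borel:
  fixes M :: "nat \<Rightarrow> 'a::second_countable_topology measure"
  assumes "\<And>i. sets (M i) = sets borel"
  shows "(\<lambda>(x, y). prefix_splice k y x) \<in> PiM UNIV M \<Otimes>\<^sub>M borel \<rightarrow>\<^sub>M PiM UNIV M"
proof -
  have "sets (PiM UNIV M) = sets (PiM UNIV (\<lambda>i::nat. borel :: 'a measure))"
    using assms by (intro sets_PiM_cong) auto
  then have eq: "sets (PiM UNIV M) = sets borel" using sets_PiM_equal_borel by simp
  have "(\<lambda>(x, y). (y, x)) \<in> PiM UNIV M \<Otimes>\<^sub>M PiM UNIV M \<rightarrow>\<^sub>M PiM UNIV M \<Otimes>\<^sub>M PiM UNIV M"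
    by measurable
  then have "(\<lambda>(x, y). prefix_splice k y x) \<in> PiM UNIV M \<Otimes>\<^sub>M PiM UNIV M \<rightarrow>\<^sub>M PiM UNIV M"
    using measurable_compose[OF _ measurable_splice[where k=k and M=M]] by (simp add: split_beta)
  moreover have "sets (PiM UNIV M \<Otimes>\<^sub>M PiM UNIV M) = sets (PiM UNIV M \<Otimes>\<^sub>M (borel :: (nat \<Rightarrow> 'a) measure))"
    using eq by (intro sets_pair_measure_cong) auto
  ultimately show ?thesis using measurable_cong_sets by blast
qed

lemma ex_replace_prefix:
  "(\<exists>ys. Q (replace_prefix ys x)) \<longleftrightarrow> (\<exists>k y. Q (prefix_splice k y x))"
proof safe
  fix ys assume "Q (replace_prefix ys x)"
  \<comment> \<open>Values of \<open>ys ! i\<close> beyond the length of \<open>ys\<close> are never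
    read by the splice.\<close>
  moreover have "replace_prefix ys x = prefix_splice (length ys) (\<lambda>i. ys ! i) x"
    by (simp add: replace_prefix_def prefix_splice_def)
  ultimately show "\<exists>k y. Q (prefix_splice k y x)" by metis
next
  fix k y assume "Q (prefix_splice k y x)"
  moreover have "prefix_splice k y x = replace_prefix (map y [0..<k]) x"
    by (auto simp: replace_prefix_def prefix_splice_def)
  ultimately show "\<exists>ys. Q (replace_prefix ys x)" by metis
qed

lemma tail_multifunction_eq: "tail_multifunction \<sigma> x = (\<Inter>k. \<Inter>y. \<sigma> (prefix_splice k y x))"
proof -
  have "z \<notin> tail_multifunction \<sigma> x \<longleftrightarrow> (\<exists>ys. z \<notin> \<sigma> (replace_prefix ys x))" for z
  proof
    assume "\<exists>ys. z \<notin> \<sigma> (replace_prefix ys x)"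
    then obtain ys where "z \<notin> \<sigma> (replace_prefix ys x)" by blast
    then show "z \<notin> tail_multifunction \<sigma> x"
      unfolding tail_multifunction_def by (auto intro!: bexI[of _ "Suc (length ys)"])
  qed (auto simp: tail_multifunction_def)
  then have "z \<notin> tail_multifunction \<sigma> x \<longleftrightarrow> (\<exists>k y. z \<notin> \<sigma> (prefix_splice k y x))" for z
    using ex_replace_prefix[of "\<lambda>w. z \<notin> \<sigma> w" x] by simp
  then show ?thesis by auto
qed

text \<open>Two successive splices collapse to one at \<open>max n k\<close>, and a splice of
  \<open>x\<close> is also one of any finite modification of \<open>x\<close>.\<close>

lemma ex_splice_tail:
  "(\<exists>n y. Q (prefix_splice n y (prefix_splice k z x))) \<longleftrightarrow> (\<exists>n y. Q (prefix_splice n y x))"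
proof safe
  fix n y assume "Q (prefix_splice n y (prefix_splice k z x))"
  moreover have "prefix_splice n y (prefix_splice k z x) = prefix_splice (max n k) (prefix_splice n y z) x"
    by (auto simp: prefix_splice_def fun_eq_iff)
  ultimately show "\<exists>n y. Q (prefix_splice n y x)" by metis
next
  fix n y assume "Q (prefix_splice n y x)"
  moreover have "prefix_splice n y x = prefix_splice (max n k) (prefix_splice n y x) (prefix_splice k z x)"
    by (auto simp: prefix_splice_def fun_eq_iff)
  ultimately show "\<exists>n y. Q (prefix_splice n y (prefix_splice k z x))" by metis
qed

theorem mainTheorem5:
  fixes M :: "nat \<Rightarrow> complex measure"
    and \<sigma> :: "(nat \<Rightarrow> complex) \<Rightarrow> complex set"
  assumes "\<And>i. prob_space (M i)"
    and "\<And>i. sets (M i) = sets borel"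
    and "closed_valued (PiM UNIV M) \<sigma>"
    and "open_measurable (PiM UNIV M) \<sigma>"
  shows "\<exists>A. closed A \<and>
    {x. tail_multifunction \<sigma> x = A} \<in> sets (completion (PiM UNIV M)) \<and>
    emeasure (completion (PiM UNIV M)) {x. tail_multifunction \<sigma> x = A} = 1"
proof -
  let ?P = "PiM UNIV M"
  let ?Q = "completion ?P"
  interpret P: prob_space ?P using assms(1) by (intro prob_space_PiM)
  interpret Q: prob_space ?Q by (rule P.prob_space_completion)
  have space: "space ?P = UNIV"
    using sets_eq_imp_space_eq[OF assms(2)] by (simp add: space_PiM)
  have closed: "closed (\<sigma> x)" for x using assms(3) by (simp add: closed_valued_def space)
  obtain \<B> :: "complex set set" where \<B>: "countable \<B>" "topological_basis \<B>"
    using ex_countable_basis by blast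
  define T where "T B = {x. \<exists>k y. \<sigma> (prefix_splice k y x) \<inter> B = {}}" for B
  have T_sets: "T B \<in> sets ?Q" if "B \<in> \<B>" for B
  proof -
    have "open B" using that \<B>(2) by (rule topological_basis_open[rotated])
    then have "space ?P - {x \<in> space ?P. \<sigma> x \<inter> B \<noteq> {}} \<in> sets ?P"
      using assms(4) by (intro sets.compl_sets) (simp add: open_measurable_def)
    then have S: "{x. \<sigma> x \<inter> B = {}} \<in> sets ?P"
      by (simp add: space set_diff_eq)
    \<comment> \<open>The quantifier over \<open>k\<close> is a countable union; only the one over
      \<open>y\<close> requires a projection.\<close>
    have "T B = (\<Union>k. fst ` ((\<lambda>(x, y). prefix_splice k y x) -` {x. \<sigma> x \<inter> B = {}} \<inter> space (?P \<Otimes>\<^sub>M borel)))"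
    proof (rule set_eqI)
      fix x
      have "x \<in> fst ` ((\<lambda>(x, y). prefix_splice k y x) -` {x. \<sigma> x \<inter> B = {}} \<inter> space (?P \<Otimes>\<^sub>M borel))
          \<longleftrightarrow> (\<exists>y. \<sigma> (prefix_splice k y x) \<inter> B = {})" for k
        by (simp add: image_iff space_pair_measure space)
      then show "x \<in> T B \<longleftrightarrow> x \<in> (\<Union>k. fst ` ((\<lambda>(x, y). prefix_splice k y x) -` {x. \<sigma> x \<inter> B = {}}
          \<inter> space (?P \<Otimes>\<^sub>M borel)))"
        unfolding UN_iff T_def mem_Collect_eq by simp
    qed
    also have "\<dots> \<in> sets ?Q"
      using measurable_sets[OF measurable_splice_borel[OF assms(2)] S]
      by (intro sets.countable_UN) (auto intro: P.measurable_projection)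
    finally show ?thesis .
  qed
  have zero_one: "AE x in ?Q. x \<in> T B \<longleftrightarrow> emeasure ?Q (T B) = 1" if "B \<in> \<B>" for B
  proof -
    have "prefix_splice k z x \<in> T B \<longleftrightarrow> x \<in> T B" for k z x
      using ex_splice_tail[of "\<lambda>w. \<sigma> w \<inter> B = {}"] by (simp add: T_def)
    then have "emeasure ?Q (T B) = 0 \<or> emeasure ?Q (T B) = 1"
      by (intro tail_set_zero_one assms(1) T_sets that)
    then show ?thesis
    proof
      assume "emeasure ?Q (T B) = 0"
      then have "T B \<in> null_sets ?Q" using T_sets[OF that] by blast
      then show ?thesis using AE_not_in[of "T B" ?Q] \<open>emeasure ?Q (T B) = 0\<close> by auto
    next
      assume 1: "emeasure ?Q (T B) = 1"
      then have "Q.prob (T B) = 1" by (simp add: measure_def)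
      then have "AE x in ?Q. x \<in> T B" using Q.prob_eq_1[OF T_sets[OF that]] by simp
      then show ?thesis using 1 by auto
    qed
  qed
  define A where "A = - \<Union>{B\<in>\<B>. emeasure ?Q (T B) = 1}"
  \<comment> \<open>Since the values of \<open>\<sigma>\<close> are closed, a point outside one of
    them has a basic neighbourhood missing it. Thus the value at \<open>x\<close> depends only on
    which of the countably many \<open>T B\<close> contain \<open>x\<close>.\<close>
  have tail_eq: "tail_multifunction \<sigma> x = - \<Union>{B\<in>\<B>. x \<in> T B}" for x
  proof -
    have "z \<notin> tail_multifunction \<sigma> x \<longleftrightarrow> (\<exists>B\<in>\<B>. x \<in> T B \<and> z \<in> B)" for z
    proof
      assume "z \<notin> tail_multifunction \<sigma> x"
      then obtain k y where "z \<in> - \<sigma> (prefix_splice k y x)" by (auto simp: tail_multifunction_eq)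
      then obtain B where "B \<in> \<B>" "z \<in> B" "B \<subseteq> - \<sigma> (prefix_splice k y x)"
        using topological_basisE[OF \<B>(2), of "- \<sigma> (prefix_splice k y x)" z] closed by blast
      then show "\<exists>B\<in>\<B>. x \<in> T B \<and> z \<in> B" unfolding T_def by blast
    qed (auto simp: tail_multifunction_eq T_def)
    then show ?thesis by blast
  qed
  have "AE x in ?Q. \<forall>B\<in>\<B>. x \<in> T B \<longleftrightarrow> emeasure ?Q (T B) = 1"
    using \<B>(1) zero_one by (simp add: AE_ball_countable)
  then have AE: "AE x in ?Q. tail_multifunction \<sigma> x = A"
  proof eventually_elim
    case (elim x)
    then have "{B\<in>\<B>. x \<in> T B} = {B\<in>\<B>. emeasure ?Q (T B) = 1}" by blast
    then show ?case by (simp add: tail_eq A_def)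
  qed
  \<comment> \<open>The exceptional set lies in a null set, hence belongs to the completion, and so
    does its complement.\<close>
  then have "AE x in ?P. \<not> tail_multifunction \<sigma> x \<noteq> A" by (simp add: AE_completion_iff)
  then have "Measurable.pred ?Q (\<lambda>x. tail_multifunction \<sigma> x \<noteq> A)" by (rule sets_completion_AE)
  then have "Measurable.pred ?Q (\<lambda>x. \<not> tail_multifunction \<sigma> x \<noteq> A)" by (rule pred_intros_logic)
  then have meas: "{x. tail_multifunction \<sigma> x = A} \<in> sets ?Q"
    by (simp add: pred_def space)
  have "closed A"
    unfolding A_def using \<B>(2) by (auto intro!: closed_Compl open_Union topological_basis_open)
  moreover have "Q.prob {x. tail_multifunction \<sigma> x = A} = 1"
    using AE Q.prob_eq_1[OF meas] by simp
  then have "emeasure ?Q {x. tail_multifunction \<sigma> x = A} = 1"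
    by (simp add: Q.emeasure_eq_measure)
  ultimately show ?thesis using meas by blast
qed

end
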